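(* Let $m_1,\ldots,m_k$ be positive integers with sum $M$ and let $\alpha=(m_1;P_2,\ldots,P_k)$ be an exact $k$-typed parking function of order $(m_1,\ldots,m_k)$. Then the number of elements of $\mathrm{fam}(\alpha)$ is $$F(\alpha)=\prod_{i=1}^{k}\frac{m_i!}{a_{i_0}!\,a_{i_1}!\cdots a_{i_{\mu_i}}!},$$ where $\mu_i=\sum_{j=1}^{i-1}m_j$ and, for $i\ge 2$ and $0\le j\le\mu_i$, $a_{i_j}$ is the number of entries of $P_i$ equal to $j$; the factor for $i=1$ is $m_1!/m_1!=1$.
   Context: There are $M$ cars, $m_i$ of them of type $i$, and $M$ parking spots in a row. Consider tuples $\alpha=(m_1;P_2,\ldots,P_k)$, where each $P_i=(p^{(i)}_1,\ldots,p^{(i)}_{m_i})$ is an ordered list of nonnegative integers (for $k=1$, $\alpha=(m_1)$). Such an $\alpha$ is an exact $k$-typed parking function (exact $k$-TPF) of order $(m_1,\ldots,m_k)$ if there is an arrangement of the $M$ cars in the $M$ spots, one car per spot, such that for all $2\le i\le k$ and $1\le j\le m_i$ the $j$-th car of type $i$ has exactly $p^{(i)}_j$ cars of types in $\{1,\ldots,i-1\}$ parked before it. An exact $k$-TPF $\beta=(m_1;Q_2,\ldots,Q_k)$ is a parking permutation of $\alpha=(m_1;P_2,\ldots,P_k)$ if for every $i=2,\ldots,k$ the list $Q_i$ is a rearrangement of the list $P_i$. $\mathrm{fam}(\alpha)$ is the set of all parking permutations of $\alpha$ (including $\alpha$ itself). *)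

theory Defs
  imports Complex_Main "HOL-Library.Multiset"
begin

(* (m1, [P2, ..., Pk]) encodes (m_1; P_2, ..., P_k); Pi is found at list position i - 2. *)
type_synonym typed_tuple = "nat \<times> nat list list"

definition pref_list :: "typed_tuple \<Rightarrow> nat \<Rightarrow> nat list" where
  "pref_list \<alpha> i = snd \<alpha> ! (i - 2)"

definition num_cars :: "typed_tuple \<Rightarrow> nat \<Rightarrow> nat" where
  "num_cars \<alpha> i = (if i = 1 then fst \<alpha> else length (pref_list \<alpha> i))"

(* (i, j) is the j-th car of type i. *)
definition cars :: "nat \<Rightarrow> typed_tuple \<Rightarrow> (nat \<times> nat) set" where
  "cars k \<alpha> = (SIGMA i : {1..k}. {1..num_cars \<alpha> i})"

definition exact_TPF :: "nat \<Rightarrow> typed_tuple \<Rightarrow> bool" where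
  "exact_TPF k \<alpha> \<longleftrightarrow>
     1 \<le> k \<and> length (snd \<alpha>) = k - 1 \<and>
     (\<exists>spot. bij_betw spot (cars k \<alpha>) {1..(\<Sum>i = 1..k. num_cars \<alpha> i)} \<and>
        (\<forall>i \<in> {2..k}. \<forall>j \<in> {1..num_cars \<alpha> i}.
           card {c \<in> cars k \<alpha>. fst c \<in> {1..i - 1} \<and> spot c < spot (i, j)}
             = pref_list \<alpha> i ! (j - 1)))"

definition exact_TPF_of_order :: "nat \<Rightarrow> (nat \<Rightarrow> nat) \<Rightarrow> typed_tuple \<Rightarrow> bool" where
  "exact_TPF_of_order k m \<alpha> \<longleftrightarrow> exact_TPF k \<alpha> \<and> (\<forall>i \<in> {1..k}. num_cars \<alpha> i = m i)"

definition parking_permutation :: "nat \<Rightarrow> typed_tuple \<Rightarrow> typed_tuple \<Rightarrow> bool" where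
  "parking_permutation k \<alpha> \<beta> \<longleftrightarrow>
     exact_TPF k \<beta> \<and> fst \<beta> = fst \<alpha> \<and>
     (\<forall>i \<in> {2..k}. mset (pref_list \<beta> i) = mset (pref_list \<alpha> i))"

definition fam :: "nat \<Rightarrow> typed_tuple \<Rightarrow> typed_tuple set" where
  "fam k \<alpha> = {\<beta>. parking_permutation k \<alpha> \<beta>}"

definition mu :: "(nat \<Rightarrow> nat) \<Rightarrow> nat \<Rightarrow> nat" where
  "mu m i = (\<Sum>j = 1..i - 1. m j)"

(* There is no list P_1. For i = 1 the only relevant index is j = 0 (as mu m 1 = 0), and
   the convention is that this multiplicity is m_1. *)
definition multiplicity_of :: "typed_tuple \<Rightarrow> nat \<Rightarrow> nat \<Rightarrow> nat" where
  "multiplicity_of \<alpha> i j = (if i = 1 then fst \<alpha> else count_list (pref_list \<alpha> i) j)"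

end

theory Submission
  imports Defs "HOL-Combinatorics.Multiset_Permutations"
begin

text \<open>
  The preference of a car of type \<open>i\<close> depends only on its own spot and on the set of spots taken
  by cars of each smaller type, not on which car of a given type stands where. Hence, in an
  arrangement that realises \<open>\<alpha>\<close>, the cars of each type may be permuted among themselves: this permutes
  each list \<open>P\<^sub>i\<close>, independently of the others. So every choice of rearrangements
  \<open>Q\<^sub>2, \<dots>, Q\<^sub>k\<close> yields again an exact typed parking function (\<open>exact_TPF_rearrange\<close>), and
  the family of \<open>\<alpha>\<close> is a full Cartesian product of sets of multiset permutations
  (\<open>fam_eq_listset\<close>). The factor for type \<open>i\<close> is a multinomial coefficient; its denominator may be
  taken over all of \<open>0, \<dots>, \<mu>\<^sub>i\<close> because a preference counts some of the \<open>\<mu>\<^sub>i\<close> cars of smaller type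
  (\<open>exact_TPF_preference_le\<close>), so that range contains every value that occurs.
\<close>

section \<open>Rearranging the preference lists\<close>

text \<open>
  Cars are numbered from 1 while list positions start at 0, so the usual permutation between
  two lists with the same multiset is conjugated by the successor function.
\<close>

lemma mset_eq_imp_permutes_from_1:
  assumes "mset xs = mset ys"
  obtains \<tau> where "\<tau> permutes {1..length ys}"
    and "\<And>j. j \<in> {1..length ys} \<Longrightarrow> xs ! (j - 1) = ys ! (\<tau> j - 1)"
proof -
  obtain p where p: "p permutes {..<length ys}" "permute_list p ys = xs"
    using mset_eq_permutation[OF assms] by blast
  define \<tau> where "\<tau> j = (if j \<in> {1..length ys} then Suc (p (j - 1)) else j)" for j
  have "bij_betw (Suc \<circ> p \<circ> (\<lambda>j. j - 1)) {1..length ys} {1..length ys}"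
  proof (intro bij_betw_trans)
    show "bij_betw (\<lambda>j. j - 1) {1..length ys} {..<length ys}"
      by (rule bij_betw_byWitness[where f' = Suc]) auto
    show "bij_betw p {..<length ys} {..<length ys}"
      using p(1) by (rule permutes_imp_bij)
    show "bij_betw Suc {..<length ys} {1..length ys}"
      by (rule bij_betw_byWitness[where f' = "\<lambda>j. j - 1"]) auto
  qed
  also have "?this \<longleftrightarrow> bij_betw \<tau> {1..length ys} {1..length ys}"
    by (rule bij_betw_cong) (simp add: \<tau>_def)
  finally have "\<tau> permutes {1..length ys}"
    by (rule bij_imp_permutes) (auto simp: \<tau>_def)
  moreover have "xs ! (j - 1) = ys ! (\<tau> j - 1)" if "j \<in> {1..length ys}" for j
    using that p by (auto simp: \<tau>_def permute_list_nth)
  ultimately show thesis using that by blast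
qed

text \<open>
  The new arrangement is the old one composed with a type-preserving permutation \<open>\<pi>\<close> of the cars.
  Since \<open>\<pi>\<close> preserves types, it maps the cars of smaller type that precede \<open>c\<close> in the new
  arrangement bijectively to those that precede \<open>\<pi> c\<close> in the old one.
\<close>

lemma exact_TPF_rearrange:
  assumes "exact_TPF k \<alpha>" and "fst \<beta> = fst \<alpha>" and "length (snd \<beta>) = k - 1"
    and mset: "\<And>i. i \<in> {2..k} \<Longrightarrow> mset (pref_list \<beta> i) = mset (pref_list \<alpha> i)"
  shows "exact_TPF k \<beta>"
proof -
  let ?M = "\<Sum>i = 1..k. num_cars \<alpha> i"
  from assms(1) obtain spot where spot: "bij_betw spot (cars k \<alpha>) {1..?M}"
    and pref: "\<And>i j. i \<in> {2..k} \<Longrightarrow> j \<in> {1..num_cars \<alpha> i} \<Longrightarrow>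
      card {c \<in> cars k \<alpha>. fst c \<in> {1..i - 1} \<and> spot c < spot (i, j)} = pref_list \<alpha> i ! (j - 1)"
    and k: "1 \<le> k"
    unfolding exact_TPF_def by blast
  have num: "num_cars \<beta> i = num_cars \<alpha> i" if "i \<in> {1..k}" for i
    using that assms(2) mset_eq_length[OF mset, of i] by (auto simp: num_cars_def)
  have cars: "cars k \<beta> = cars k \<alpha>"
    unfolding cars_def using num by (intro Sigma_cong) auto
  have "\<exists>\<tau>. \<tau> permutes {1..num_cars \<alpha> i} \<and>
      (i \<in> {2..k} \<longrightarrow> (\<forall>j \<in> {1..num_cars \<alpha> i}. pref_list \<beta> i ! (j - 1) = pref_list \<alpha> i ! (\<tau> j - 1)))"
    for i
  proof (cases "i \<in> {2..k}")
    case True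
    then have "num_cars \<alpha> i = length (pref_list \<alpha> i)"
      by (simp add: num_cars_def)
    with mset_eq_imp_permutes_from_1[OF mset[OF True]] show ?thesis
      by metis
  qed (auto intro: permutes_id)
  then obtain \<tau> where \<tau>: "\<And>i. \<tau> i permutes {1..num_cars \<alpha> i}"
    and \<tau>_nth: "\<And>i j. i \<in> {2..k} \<Longrightarrow> j \<in> {1..num_cars \<alpha> i} \<Longrightarrow>
      pref_list \<beta> i ! (j - 1) = pref_list \<alpha> i ! (\<tau> i j - 1)"
    by metis
  define \<pi> where "\<pi> = (\<lambda>(i, j). (i, \<tau> i j))"
  have fst_\<pi>: "fst (\<pi> c) = fst c" for c
    by (simp add: \<pi>_def split_beta)
  have \<pi>: "bij_betw \<pi> (cars k \<alpha>) (cars k \<alpha>)"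
    unfolding cars_def \<pi>_def
    by (rule bij_betw_byWitness[where f' = "\<lambda>(i, j). (i, inv (\<tau> i) j)"])
       (use \<tau> permutes_in_image[OF \<tau>] permutes_in_image[OF permutes_inv[OF \<tau>]] in
         \<open>auto simp: permutes_inverses[OF \<tau>] simp del: atLeastAtMost_iff\<close>)
  have "bij_betw (spot \<circ> \<pi>) (cars k \<beta>) {1..\<Sum>i = 1..k. num_cars \<beta> i}"
    using bij_betw_trans[OF \<pi> spot] num cars by simp
  moreover have "card {c \<in> cars k \<beta>. fst c \<in> {1..i - 1} \<and> (spot \<circ> \<pi>) c < (spot \<circ> \<pi>) (i, j)}
      = pref_list \<beta> i ! (j - 1)" if i: "i \<in> {2..k}" and "j \<in> {1..num_cars \<beta> i}" for i j
  proof -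
    have j: "j \<in> {1..num_cars \<alpha> i}" "\<tau> i j \<in> {1..num_cars \<alpha> i}"
      using that num[of i] permutes_in_image[OF \<tau>, of i j] by auto
    have "bij_betw \<pi> {c \<in> cars k \<alpha>. fst (\<pi> c) \<in> {1..i - 1} \<and> spot (\<pi> c) < spot (\<pi> (i, j))}
        {c \<in> cars k \<alpha>. fst c \<in> {1..i - 1} \<and> spot c < spot (\<pi> (i, j))}"
      by (rule bij_betw_Collect[OF \<pi>]) simp
    from bij_betw_same_card[OF this]
    have "card {c \<in> cars k \<beta>. fst c \<in> {1..i - 1} \<and> (spot \<circ> \<pi>) c < (spot \<circ> \<pi>) (i, j)}
        = card {c \<in> cars k \<alpha>. fst c \<in> {1..i - 1} \<and> spot c < spot (i, \<tau> i j)}"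
      by (simp add: fst_\<pi> cars) (simp add: \<pi>_def)
    also have "\<dots> = pref_list \<beta> i ! (j - 1)"
      using pref[OF i j(2)] \<tau>_nth[OF i j(1)] by simp
    finally show ?thesis .
  qed
  ultimately show ?thesis
    unfolding exact_TPF_def using k assms(3) by blast
qed

lemma exact_TPF_preference_le:
  assumes "exact_TPF k \<alpha>" and i: "i \<in> {2..k}" and "x \<in> set (pref_list \<alpha> i)"
  shows "x \<le> (\<Sum>l = 1..i - 1. num_cars \<alpha> l)"
proof -
  obtain n where n: "n < length (pref_list \<alpha> i)" "x = pref_list \<alpha> i ! n"
    using assms(3) by (metis in_set_conv_nth)
  then have "Suc n \<in> {1..num_cars \<alpha> i}"
    using i by (simp add: num_cars_def)
  with assms(1) i obtain spot :: "nat \<times> nat \<Rightarrow> nat" where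
    "card {c \<in> cars k \<alpha>. fst c \<in> {1..i - 1} \<and> spot c < spot (i, Suc n)} = pref_list \<alpha> i ! (Suc n - 1)"
    unfolding exact_TPF_def by blast
  then have "x = card {c \<in> cars k \<alpha>. fst c \<in> {1..i - 1} \<and> spot c < spot (i, Suc n)}"
    using n by simp
  also have "\<dots> \<le> card (SIGMA l : {1..i - 1}. {1..num_cars \<alpha> l})"
    by (rule card_mono) (auto simp: cars_def)
  finally show ?thesis
    by simp
qed

section \<open>The family as a Cartesian product\<close>

lemma in_listset_iff:
  "xs \<in> listset As \<longleftrightarrow> length xs = length As \<and> (\<forall>n < length As. xs ! n \<in> As ! n)"
proof (induction As arbitrary: xs)
  case (Cons A As)
  then show ?case
    by (cases xs) (auto simp: set_Cons_def less_Suc_eq_0_disj)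
qed simp

lemma card_listset: "card (listset As) = (\<Prod>A\<leftarrow>As. card A)"
proof (induction As)
  case (Cons A As)
  have "listset (A # As) = (\<lambda>(x, xs). x # xs) ` (A \<times> listset As)"
    by (auto simp: set_Cons_def)
  moreover have "inj_on (\<lambda>(x, xs). x # xs) (A \<times> listset As)"
    by (auto simp: inj_on_def)
  ultimately show ?case
    using Cons by (simp add: card_image card_cartesian_product)
qed simp

text \<open>
  Position \<open>n\<close> of the list stored in \<open>\<alpha>\<close> holds the preferences of type \<open>n + 2\<close>; \<open>shift\<close> below
  translates between the two indexings.
\<close>

lemma fam_eq_listset:
  assumes "exact_TPF k \<alpha>"
  shows "fam k \<alpha> =
    Pair (fst \<alpha>) ` listset (map (\<lambda>P. permutations_of_multiset (mset P)) (snd \<alpha>))"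
proof -
  have k: "length (snd \<alpha>) = k - 1" "1 \<le> k"
    using assms by (auto simp: exact_TPF_def)
  have shift: "(\<forall>i \<in> {2..k}. Q (i - 2)) \<longleftrightarrow> (\<forall>n < k - 1. Q n)" for Q :: "nat \<Rightarrow> bool"
  proof safe
    fix n assume "\<forall>i \<in> {2..k}. Q (i - 2)" "n < k - 1"
    then show "Q n" by (auto dest!: bspec[where x = "n + 2"])
  qed auto
  have "\<beta> \<in> fam k \<alpha> \<longleftrightarrow> fst \<beta> = fst \<alpha> \<and> length (snd \<beta>) = k - 1 \<and>
      (\<forall>n < k - 1. mset (snd \<beta> ! n) = mset (snd \<alpha> ! n))" for \<beta>
    using exact_TPF_rearrange[OF assms, of \<beta>]
    unfolding fam_def parking_permutation_def mem_Collect_eq shift[symmetric] pref_list_def[symmetric]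
    by (auto simp: exact_TPF_def)
  then show ?thesis
    using k by (auto simp: in_listset_iff permutations_of_multiset_def image_iff prod_eq_iff)
qed

section \<open>Counting\<close>

text \<open>
  In the multinomial coefficient, the product over the values that occur can be extended to all
  values up to the bound, since the others contribute \<open>0! = 1\<close>.
\<close>

lemma card_permutations_of_mset_bounded:
  assumes "\<forall>x \<in> set xs. x \<le> (b :: nat)"
  shows "real (card (permutations_of_multiset (mset xs))) =
    fact (length xs) / (\<Prod>j = 0..b. fact (count_list xs j))"
proof -
  have "(\<Prod>j = 0..b. fact (count_list xs j) :: nat) = (\<Prod>x \<in> set_mset (mset xs). fact (count (mset xs) x))"
    using assms by (intro prod.mono_neutral_cong_right)
      (auto simp: count_mset count_list_0_iff)
  then have "card (permutations_of_multiset (mset xs)) * (\<Prod>j = 0..b. fact (count_list xs j))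
      = fact (length xs)"
    by (simp only: card_permutations_of_multiset_aux size_mset)
  then have "real (card (permutations_of_multiset (mset xs)) * (\<Prod>j = 0..b. fact (count_list xs j)))
      = real (fact (length xs))"
    by (rule arg_cong)
  then show ?thesis
    by (simp add: eq_divide_eq)
qed

theorem theorem5p7:
  fixes k :: nat and m :: "nat \<Rightarrow> nat" and \<alpha> :: typed_tuple
  assumes "k \<ge> 1"
    and "\<forall>i \<in> {1..k}. m i > 0"
    and "exact_TPF_of_order k m \<alpha>"
  shows "real (card (fam k \<alpha>)) =
    (\<Prod>i = 1..k. fact (m i) / (\<Prod>j = 0..mu m i. fact (multiplicity_of \<alpha> i j)))"
proof -
  let ?F = "\<lambda>i. fact (m i) / (\<Prod>j = 0..mu m i. fact (multiplicity_of \<alpha> i j)) :: real"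
  have \<alpha>: "exact_TPF k \<alpha>" and m: "\<And>i. i \<in> {1..k} \<Longrightarrow> num_cars \<alpha> i = m i"
    using assms(3) by (auto simp: exact_TPF_of_order_def)
  have len: "length (snd \<alpha>) = k - 1"
    using \<alpha> by (simp add: exact_TPF_def)
  have factor: "real (card (permutations_of_multiset (mset (pref_list \<alpha> i)))) = ?F i"
    if i: "i \<in> {2..k}" for i
  proof -
    have "(\<Sum>l = 1..i - 1. num_cars \<alpha> l) = mu m i"
      unfolding mu_def using i m by (intro sum.cong) auto
    then have "\<forall>x \<in> set (pref_list \<alpha> i). x \<le> mu m i"
      using exact_TPF_preference_le[OF \<alpha> i] by auto
    moreover have "length (pref_list \<alpha> i) = m i"
      using i m[of i] by (simp add: num_cars_def)
    ultimately show ?thesis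
      using i by (simp add: card_permutations_of_mset_bounded multiplicity_of_def)
  qed
  have "card (fam k \<alpha>) = (\<Prod>P\<leftarrow>snd \<alpha>. card (permutations_of_multiset (mset P)))"
    by (simp add: fam_eq_listset[OF \<alpha>] card_image inj_on_def card_listset o_def)
  also have "\<dots> = (\<Prod>n < k - 1. card (permutations_of_multiset (mset (snd \<alpha> ! n))))"
    by (simp add: prod.list_conv_set_nth len atLeast0LessThan)
  also have "\<dots> = (\<Prod>i = 2..k. card (permutations_of_multiset (mset (pref_list \<alpha> i))))"
    by (rule prod.reindex_bij_witness[where i = "\<lambda>i. i - 2" and j = "\<lambda>n. n + 2"])
       (auto simp: pref_list_def)
  finally have "real (card (fam k \<alpha>)) = (\<Prod>i = 2..k. ?F i)"
    using factor by simp
  also have "\<dots> = (\<Prod>i = 1..k. ?F i)"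
  proof -
    have "?F 1 = 1"
      using assms(1) m[of 1] by (simp add: mu_def multiplicity_of_def num_cars_def)
    then show ?thesis
      using prod.atLeast_Suc_atMost[of 1 k ?F] assms(1) by (simp add: numeral_2_eq_2)
  qed
  finally show ?thesis .
qed

end
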